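(* The false alarm and detection probabilities of the decentralized detector, $$P^F_d=\Pr[\Lambda_i\ge\tau_i\text{ for some }i\in\{1,\dots,N\}\mid H_0],\qquad P^D_d=\Pr[\Lambda_i\ge\tau_i\text{ for some }i\in\{1,\dots,N\}\mid H_1],$$ satisfy $$P^F_d=1-\prod_{i=1}^N(1-P^F_i)\qquad\text{and}\qquad P^D_d=1-\prod_{i=1}^N(1-P^D_i).$$
   Context: Interconnected system: for $i\in\{1,\dots,N\}$, $x_i(k+1)=A_{ii}x_i(k)+B_iu_i(k)+B^a_iu^a_i(k)+w_i(k)$, $y_i(k)=C_ix_i(k)+v_i(k)$, where $B_i=[A_{i1}\ \cdots\ A_{i,i-1}\ A_{i,i+1}\ \cdots\ A_{iN}]$ and $u_i=[x_1^{\mathsf T}\ \cdots\ x_{i-1}^{\mathsf T}\ x_{i+1}^{\mathsf T}\ \cdots\ x_N^{\mathsf T}]^{\mathsf T}$. The noises $w_i(k)\sim\mathcal N(0,\Sigma_{w_i})$ and $v_i(k)\sim\mathcal N(0,\Sigma_{v_i})$ are independent over time, of each other, and across subsystems. The initial state and the attack $u^a_i$ are deterministic. Fix a horizon $T>0$. Let $Y_i=[y_i(1)^{\mathsf T}\cdots y_i(T)^{\mathsf T}]^{\mathsf T}$, $U^a_i=[u^a_i(0)^{\mathsf T}\cdots u^a_i(T-1)^{\mathsf T}]^{\mathsf T}$. Define $\mathcal O_i=[(C_iA_{ii})^{\mathsf T}\cdots(C_iA_{ii}^T)^{\mathsf T}]^{\mathsf T}$, and let $\mathcal F^{(a)}_i,\mathcal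 F^{(u)}_i,\mathcal F^{(w)}_i$ be the $T\times T$ block matrices whose $(j,l)$ block is, for $j\ge l$, $C_iA_{ii}^{j-l}B^a_i$, $C_iA_{ii}^{j-l}B_i$, $C_iA_{ii}^{j-l}$ respectively, and $0$ for $j<l$. Let the rows of $N_i$ form a basis of the left null space of $[\mathcal O_i\ \ \mathcal F^{(u)}_i]$ (assumed nontrivial). Set $\widetilde Y_i=N_iY_i$, with mean $\beta_i=N_i\mathcal F^{(a)}_iU^a_i$ and covariance $\Sigma_i=N_i[\mathcal F^{(w)}_i(I_T\otimes\Sigma_{w_i})(\mathcal F^{(w)}_i)^{\mathsf T}+(I_T\otimes\Sigma_{v_i})]N_i^{\mathsf T}$, assumed invertible. With thresholds $\tau_i\ge0$, the $i$-th local detector raises an alarm if $\Lambda_i:=\widetilde Y_i^{\mathsf T}\Sigma_i^{-1}\widetilde Y_i\ge\tau_i$; the decentralized detector raises an alarm if at least one local detector does. $H_0$: no attack (all $\beta_i=0$). $H_1$: the system is under the fixed deterministic attack with time-aggregated components $U^a_1,\dots,U^a_N$. The local probabilities are $P^F_i=\Pr[\Lambda_i\ge\tau_i\mid H_0]$ and $P^D_i=\Pr[\Lambda_i\ge\tau_i\mid H_1]$. *)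

theory Defs
  imports
    "HOL-Probability.Probability"
    "Jordan_Normal_Form.Matrix_Kernel"
    "Jordan_Normal_Form.Gauss_Jordan_Elimination"
begin

(* Matrix notation below is that of Jordan_Normal_Form, not of HOL-Analysis. *)
hide_type (open) Finite_Cartesian_Product.vec
hide_const (open) Finite_Cartesian_Product.vec Finite_Cartesian_Product.row
  Finite_Cartesian_Product.rows Finite_Cartesian_Product.column
  Finite_Cartesian_Product.mat Finite_Cartesian_Product.transpose
  Finite_Cartesian_Product.matrix
no_notation vec_nth (infixl \<open>$\<close> 90)
no_notation inner (infix \<open>\<bullet>\<close> 70)

section \<open>Block vectors and matrices\<close>

definition stack_vecs :: "real vec list \<Rightarrow> real vec" where
  "stack_vecs vs = foldr (@\<^sub>v) vs (0\<^sub>v 0)"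

definition append_cols :: "real mat \<Rightarrow> real mat \<Rightarrow> real mat" where
  "append_cols A B = four_block_mat A B (0\<^sub>m 0 (dim_col A)) (0\<^sub>m 0 (dim_col B))"

(* The first argument is the common number of columns (resp. rows) of the blocks. *)
definition stack_rows :: "nat \<Rightarrow> real mat list \<Rightarrow> real mat" where
  "stack_rows c As = foldr (@\<^sub>r) As (0\<^sub>m 0 c)"

definition stack_cols :: "nat \<Rightarrow> real mat list \<Rightarrow> real mat" where
  "stack_cols r As = foldr append_cols As (0\<^sub>m r 0)"

(* T x T blocks of size r x c; block (j, l) is g (j - l) for j >= l and 0 for j < l. *)
definition lower_block_toeplitz :: "nat \<Rightarrow> nat \<Rightarrow> nat \<Rightarrow> (nat \<Rightarrow> real mat) \<Rightarrow> real mat" where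
  "lower_block_toeplitz r c T g =
     stack_rows (T * c)
       (map (\<lambda>j. stack_cols r (map (\<lambda>l. if l \<le> j then g (j - l) else 0\<^sub>m r c) [1..<T+1])) [1..<T+1])"

(* The rows of N form a basis of the left null space {x. x^T A = 0} = ker A^T. *)
definition left_null_basis :: "real mat \<Rightarrow> real mat \<Rightarrow> bool" where
  "left_null_basis A N \<longleftrightarrow>
     dim_col N = dim_row A \<and> distinct (rows N) \<and>
     kernel.basis (dim_row A) A\<^sup>T (set (rows N))"

section \<open>Gaussian random vectors\<close>

definition vec_borel :: "nat \<Rightarrow> real vec measure" where
  "vec_borel d = vimage_algebra (carrier_vec d) (\<lambda>x. \<lambda>j\<in>{..<d}. x $ j) (\<Pi>\<^sub>M j\<in>{..<d}. borel)"

(* Possibly singular covariance: every linear functional a^T X is univariate normal with mean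
   a^T mu and variance a^T Sigma a, variance 0 meaning almost surely constant. *)
definition normal_vec ::
  "'w measure \<Rightarrow> nat \<Rightarrow> real vec \<Rightarrow> real mat \<Rightarrow> ('w \<Rightarrow> real vec) \<Rightarrow> bool" where
  "normal_vec M d \<mu> \<Sigma> X \<longleftrightarrow>
     \<mu> \<in> carrier_vec d \<and> \<Sigma> \<in> carrier_mat d d \<and> \<Sigma>\<^sup>T = \<Sigma> \<and>
     (\<forall>a\<in>carrier_vec d. a \<bullet> (\<Sigma> *\<^sub>v a) \<ge> 0) \<and>
     X \<in> measurable M (vec_borel d) \<and>
     (\<forall>a\<in>carrier_vec d.
        if a \<bullet> (\<Sigma> *\<^sub>v a) = 0 then AE \<omega> in M. a \<bullet> X \<omega> = a \<bullet> \<mu>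
        else distributed M lborel (\<lambda>\<omega>. a \<bullet> X \<omega>)
               (\<lambda>t. ennreal (normal_density (a \<bullet> \<mu>) (sqrt (a \<bullet> (\<Sigma> *\<^sub>v a))) t)))"

section \<open>The interconnected system\<close>

(* Subsystems are indexed by {1..num_sub}; dim_x, dim_y and dim_a are the dimensions of the state,
   the measurement and the attack of each subsystem; A_mat S i j is A_ij. *)
record net_system =
  num_sub :: nat
  dim_x :: "nat \<Rightarrow> nat"
  dim_y :: "nat \<Rightarrow> nat"
  dim_a :: "nat \<Rightarrow> nat"
  A_mat :: "nat \<Rightarrow> nat \<Rightarrow> real mat"
  Ba_mat :: "nat \<Rightarrow> real mat"
  C_mat :: "nat \<Rightarrow> real mat"
  Sigma_w :: "nat \<Rightarrow> real mat"
  Sigma_v :: "nat \<Rightarrow> real mat"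
  x_init :: "nat \<Rightarrow> real vec"

abbreviation subsystems :: "net_system \<Rightarrow> nat set" where
  "subsystems S \<equiv> {1..num_sub S}"

definition well_dimensioned :: "net_system \<Rightarrow> bool" where
  "well_dimensioned S \<longleftrightarrow> (\<forall>i\<in>subsystems S.
     (\<forall>j\<in>subsystems S. A_mat S i j \<in> carrier_mat (dim_x S i) (dim_x S j)) \<and>
     Ba_mat S i \<in> carrier_mat (dim_x S i) (dim_a S i) \<and>
     C_mat S i \<in> carrier_mat (dim_y S i) (dim_x S i) \<and>
     Sigma_w S i \<in> carrier_mat (dim_x S i) (dim_x S i) \<and>
     Sigma_v S i \<in> carrier_mat (dim_y S i) (dim_y S i) \<and>
     x_init S i \<in> carrier_vec (dim_x S i))"

definition others :: "net_system \<Rightarrow> nat \<Rightarrow> nat list" where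
  "others S i = [j \<leftarrow> [1..<num_sub S + 1]. j \<noteq> i]"

definition B_mat :: "net_system \<Rightarrow> nat \<Rightarrow> real mat" where
  "B_mat S i = stack_cols (dim_x S i) (map (\<lambda>j. A_mat S i j) (others S i))"

definition dim_u :: "net_system \<Rightarrow> nat \<Rightarrow> nat" where
  "dim_u S i = (\<Sum>j\<leftarrow>others S i. dim_x S j)"

(* A signal s assigns to subsystem i and time k the vector s i k. *)
type_synonym signal = "nat \<Rightarrow> nat \<Rightarrow> real vec"

definition attack_signal :: "net_system \<Rightarrow> signal \<Rightarrow> bool" where
  "attack_signal S ua \<longleftrightarrow> (\<forall>i\<in>subsystems S. \<forall>k. ua i k \<in> carrier_vec (dim_a S i))"

definition no_attack :: "net_system \<Rightarrow> signal" where
  "no_attack S = (\<lambda>i k. 0\<^sub>v (dim_a S i))"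

(* State x_i(k) for one realization w of the process noise; time is the first argument because
   the recursion runs over all subsystems simultaneously. *)
primrec state :: "net_system \<Rightarrow> signal \<Rightarrow> signal \<Rightarrow> nat \<Rightarrow> nat \<Rightarrow> real vec" where
  "state S ua w 0 = (\<lambda>i. x_init S i)"
| "state S ua w (Suc k) = (\<lambda>i.
     A_mat S i i *\<^sub>v state S ua w k i
     + B_mat S i *\<^sub>v stack_vecs (map (\<lambda>j. state S ua w k j) (others S i))
     + Ba_mat S i *\<^sub>v ua i k + w i k)"

definition measurement :: "net_system \<Rightarrow> signal \<Rightarrow> signal \<Rightarrow> signal \<Rightarrow> signal" where
  "measurement S ua w v i k = C_mat S i *\<^sub>v state S ua w k i + v i k"

(* Joint independence of all w_i(k) (Inl) and v_i(k) (Inr). *)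
definition gaussian_noises ::
  "'w measure \<Rightarrow> net_system \<Rightarrow> (nat \<Rightarrow> nat \<Rightarrow> 'w \<Rightarrow> real vec) \<Rightarrow> (nat \<Rightarrow> nat \<Rightarrow> 'w \<Rightarrow> real vec) \<Rightarrow> bool" where
  "gaussian_noises M S w v \<longleftrightarrow>
     (\<forall>i\<in>subsystems S. \<forall>k.
        normal_vec M (dim_x S i) (0\<^sub>v (dim_x S i)) (Sigma_w S i) (w i k) \<and>
        normal_vec M (dim_y S i) (0\<^sub>v (dim_y S i)) (Sigma_v S i) (v i k)) \<and>
     prob_space.indep_vars M
       (case_sum (\<lambda>(i, k). vec_borel (dim_x S i)) (\<lambda>(i, k). vec_borel (dim_y S i)))
       (case_sum (\<lambda>(i, k). w i k) (\<lambda>(i, k). v i k))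
       ((subsystems S \<times> UNIV) <+> (subsystems S \<times> UNIV))"

section \<open>Time-aggregated quantities over the horizon T\<close>

definition Y_agg :: "net_system \<Rightarrow> nat \<Rightarrow> signal \<Rightarrow> signal \<Rightarrow> signal \<Rightarrow> nat \<Rightarrow> real vec" where
  "Y_agg S T ua w v i = stack_vecs (map (\<lambda>k. measurement S ua w v i k) [1..<T+1])"

definition Ua_agg :: "nat \<Rightarrow> signal \<Rightarrow> nat \<Rightarrow> real vec" where
  "Ua_agg T ua i = stack_vecs (map (\<lambda>k. ua i k) [0..<T])"

definition obs_mat :: "net_system \<Rightarrow> nat \<Rightarrow> nat \<Rightarrow> real mat" where
  "obs_mat S T i = stack_rows (dim_x S i) (map (\<lambda>k. C_mat S i * A_mat S i i ^\<^sub>m k) [1..<T+1])"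

definition F_a :: "net_system \<Rightarrow> nat \<Rightarrow> nat \<Rightarrow> real mat" where
  "F_a S T i = lower_block_toeplitz (dim_y S i) (dim_a S i) T
     (\<lambda>k. C_mat S i * A_mat S i i ^\<^sub>m k * Ba_mat S i)"

definition F_u :: "net_system \<Rightarrow> nat \<Rightarrow> nat \<Rightarrow> real mat" where
  "F_u S T i = lower_block_toeplitz (dim_y S i) (dim_u S i) T
     (\<lambda>k. C_mat S i * A_mat S i i ^\<^sub>m k * B_mat S i)"

definition F_w :: "net_system \<Rightarrow> nat \<Rightarrow> nat \<Rightarrow> real mat" where
  "F_w S T i = lower_block_toeplitz (dim_y S i) (dim_x S i) T
     (\<lambda>k. C_mat S i * A_mat S i i ^\<^sub>m k)"

definition nuisance_mat :: "net_system \<Rightarrow> nat \<Rightarrow> nat \<Rightarrow> real mat" where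
  "nuisance_mat S T i = append_cols (obs_mat S T i) (F_u S T i)"

section \<open>Local and decentralized detectors\<close>

(* Nm i is the matrix N_i. *)

definition Y_tilde ::
  "net_system \<Rightarrow> nat \<Rightarrow> (nat \<Rightarrow> real mat) \<Rightarrow> signal \<Rightarrow> signal \<Rightarrow> signal \<Rightarrow> nat \<Rightarrow> real vec" where
  "Y_tilde S T Nm ua w v i = Nm i *\<^sub>v Y_agg S T ua w v i"

definition beta :: "net_system \<Rightarrow> nat \<Rightarrow> (nat \<Rightarrow> real mat) \<Rightarrow> signal \<Rightarrow> nat \<Rightarrow> real vec" where
  "beta S T Nm ua i = Nm i *\<^sub>v (F_a S T i *\<^sub>v Ua_agg T ua i)"

(* H_0 is the zero attack; all beta_i then vanish. *)
lemma beta_no_attack: "beta S T Nm (no_attack S) i = 0\<^sub>v (dim_row (Nm i))"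
proof -
  have mult_zero: "A *\<^sub>v 0\<^sub>v n = (0\<^sub>v (dim_row A) :: real vec)" for A n
    by (intro eq_vecI) (auto simp: scalar_prod_def)
  have "stack_vecs (map (\<lambda>k. 0\<^sub>v d) ks) = 0\<^sub>v (length ks * d)" for d and ks :: "nat list"
    by (induction ks) (auto simp: stack_vecs_def)
  then show ?thesis
    by (simp add: beta_def Ua_agg_def no_attack_def mult_zero)
qed

(* The block diagonal matrix of T copies of X is the Kronecker product of I_T and X. *)
definition Sigma_tilde :: "net_system \<Rightarrow> nat \<Rightarrow> (nat \<Rightarrow> real mat) \<Rightarrow> nat \<Rightarrow> real mat" where
  "Sigma_tilde S T Nm i =
     Nm i * (F_w S T i * diag_block_mat (replicate T (Sigma_w S i)) * (F_w S T i)\<^sup>T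
             + diag_block_mat (replicate T (Sigma_v S i))) * (Nm i)\<^sup>T"

definition test_stat ::
  "net_system \<Rightarrow> nat \<Rightarrow> (nat \<Rightarrow> real mat) \<Rightarrow> signal \<Rightarrow> signal \<Rightarrow> signal \<Rightarrow> nat \<Rightarrow> real" where
  "test_stat S T Nm ua w v i =
     Y_tilde S T Nm ua w v i \<bullet>
       (the (mat_inverse (Sigma_tilde S T Nm i)) *\<^sub>v Y_tilde S T Nm ua w v i)"

(* Probability of a local, resp. decentralized, alarm when the system is under the attack ua. *)

definition local_alarm_prob ::
  "'w measure \<Rightarrow> net_system \<Rightarrow> nat \<Rightarrow> (nat \<Rightarrow> real mat) \<Rightarrow>
   (nat \<Rightarrow> nat \<Rightarrow> 'w \<Rightarrow> real vec) \<Rightarrow> (nat \<Rightarrow> nat \<Rightarrow> 'w \<Rightarrow> real vec) \<Rightarrow>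
   (nat \<Rightarrow> real) \<Rightarrow> signal \<Rightarrow> nat \<Rightarrow> real" where
  "local_alarm_prob M S T Nm w v \<tau> ua i =
     measure M {\<omega> \<in> space M. test_stat S T Nm ua (\<lambda>i k. w i k \<omega>) (\<lambda>i k. v i k \<omega>) i \<ge> \<tau> i}"

definition decentralized_alarm_prob ::
  "'w measure \<Rightarrow> net_system \<Rightarrow> nat \<Rightarrow> (nat \<Rightarrow> real mat) \<Rightarrow>
   (nat \<Rightarrow> nat \<Rightarrow> 'w \<Rightarrow> real vec) \<Rightarrow> (nat \<Rightarrow> nat \<Rightarrow> 'w \<Rightarrow> real vec) \<Rightarrow>
   (nat \<Rightarrow> real) \<Rightarrow> signal \<Rightarrow> real" where
  "decentralized_alarm_prob M S T Nm w v \<tau> ua =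
     measure M {\<omega> \<in> space M. \<exists>i\<in>subsystems S.
       test_stat S T Nm ua (\<lambda>i k. w i k \<omega>) (\<lambda>i k. v i k \<omega>) i \<ge> \<tau> i}"

end

theory Submission
  imports Defs
begin

text \<open>
  The alarm of the decentralized detector is the union of the local alarms, so both formulas follow
  by passing to the complement once the local statistics are known to be independent. This is not
  immediate, because the measurements of a subsystem depend, through the states of its
  neighbours, on the noises of the whole network.

  The projection by \<open>Nm i\<close> is what decouples the subsystems. By linearity, the state of subsystem
  \<open>i\<close> is its isolated state, driven by its own attack and its own process noise only, plus
  the response to the neighbours' states (\<open>state_decomposition\<close>). Stacked over the horizon,
  the measurements of this response form a vector \<open>F_u * U\<close> (\<open>F_u_mult_interconnection\<close>),
  which \<open>Nm i\<close> annihilates (\<open>left_null_basis_cancels_F_u\<close>). Hence the \<open>i\<close>-th statistic is a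
  function of the noises of subsystem \<open>i\<close> alone (\<open>test_stat_eq_isolated_stat\<close>). The functions
  are measurable and read disjoint groups of jointly independent variables, so the statistics are
  independent (\<open>indep_vars_isolated_stat\<close>).

  The argument is the same for every deterministic attack, so \<open>H_0\<close> is the case of the zero attack.
  Unlike the inputs from the neighbours, the initial state is deterministic and may remain in the
  isolated state.
\<close>

section \<open>Stacked vectors and block matrices\<close>

text \<open>The stacks over \<open>[1..<T+1]\<close> are treated as a whole, not split at their last block.\<close>

declare upt_Suc [simp del]

lemma mult_mat_vec_closed: "A \<in> carrier_mat r c \<Longrightarrow> A *\<^sub>v x \<in> carrier_vec r"
  by (auto intro: carrier_vecI)

lemma pow_mat_Suc_left:
  assumes A: "A \<in> carrier_mat n n"
  shows "A * A ^\<^sub>m k = A ^\<^sub>m (Suc k)"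
proof (induction k)
  case 0
  then show ?case using A by simp
next
  case (Suc k)
  have "A * A ^\<^sub>m (Suc k) = A * A ^\<^sub>m k * A"
    using assoc_mult_mat[OF A pow_carrier_mat[OF A, of k] A] by simp
  then show ?case by (simp only: Suc.IH pow_mat.simps)
qed

lemma stack_vecs_simps [simp]:
  "stack_vecs [] = 0\<^sub>v 0"
  "stack_vecs (x # xs) = x @\<^sub>v stack_vecs xs"
  by (simp_all add: stack_vecs_def)

lemma stack_vecs_carrier:
  assumes "\<And>j. j \<in> set js \<Longrightarrow> f j \<in> carrier_vec (d j)"
  shows "stack_vecs (map f js) \<in> carrier_vec (\<Sum>j\<leftarrow>js. d j)"
  using assms by (induction js) auto

lemma stack_vecs_carrier_const:
  assumes "\<And>j. j \<in> set js \<Longrightarrow> f j \<in> carrier_vec d"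
  shows "stack_vecs (map f js) \<in> carrier_vec (length js * d)"
  using stack_vecs_carrier[of js f "\<lambda>_. d"] assms by (simp add: sum_list_triv)

lemma stack_vecs_add:
  assumes "\<And>j. j \<in> set js \<Longrightarrow> f j \<in> carrier_vec d" "\<And>j. j \<in> set js \<Longrightarrow> g j \<in> carrier_vec d"
  shows "stack_vecs (map (\<lambda>j. f j + g j) js) = stack_vecs (map f js) + stack_vecs (map g js)"
  using assms
proof (induction js)
  case (Cons j js)
  show ?case
    using append_vec_add[of "f j" d "g j" "stack_vecs (map f js)" "length js * d" "stack_vecs (map g js)"]
      Cons stack_vecs_carrier_const[of js f d] stack_vecs_carrier_const[of js g d]
    by simp
qed (auto intro: eq_vecI)

lemma append_cols_carrier:
  assumes "A \<in> carrier_mat r c1" "B \<in> carrier_mat r c2"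
  shows "append_cols A B \<in> carrier_mat r (c1 + c2)"
  using assms unfolding append_cols_def by auto

text \<open>The lower blocks of the four-block matrix have no rows, so they contribute an empty
  vector to the product.\<close>

lemma append_cols_mult_vec:
  assumes A: "A \<in> carrier_mat r c1" and B: "B \<in> carrier_mat r c2"
    and a: "a \<in> carrier_vec c1" and b: "b \<in> carrier_vec c2"
  shows "append_cols A B *\<^sub>v (a @\<^sub>v b) = A *\<^sub>v a + B *\<^sub>v b"
proof -
  have "append_cols A B *\<^sub>v (a @\<^sub>v b)
      = (A *\<^sub>v a + B *\<^sub>v b) @\<^sub>v (0\<^sub>m 0 c1 *\<^sub>v a + 0\<^sub>m 0 c2 *\<^sub>v b)"
    using A B unfolding append_cols_def
    by (subst four_block_mat_mult_vec[OF A B _ _ a b]) auto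
  also have "\<dots> = A *\<^sub>v a + B *\<^sub>v b"
    by (rule eq_vecI) auto
  finally show ?thesis .
qed

lemma stack_cols_simps [simp]:
  "stack_cols r [] = 0\<^sub>m r 0"
  "stack_cols r (A # As) = append_cols A (stack_cols r As)"
  by (simp_all add: stack_cols_def)

lemma stack_rows_simps [simp]:
  "stack_rows c [] = 0\<^sub>m 0 c"
  "stack_rows c (A # As) = A @\<^sub>r stack_rows c As"
  by (simp_all add: stack_rows_def)

lemma stack_cols_carrier:
  assumes "\<And>j. j \<in> set js \<Longrightarrow> G j \<in> carrier_mat r (d j)"
  shows "stack_cols r (map G js) \<in> carrier_mat r (\<Sum>j\<leftarrow>js. d j)"
  using assms by (induction js) (auto intro!: append_cols_carrier)

lemma stack_rows_carrier:
  assumes "\<And>j. j \<in> set js \<Longrightarrow> R j \<in> carrier_mat r c"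
  shows "stack_rows c (map R js) \<in> carrier_mat (length js * r) c"
  using assms by (induction js) auto

lemma stack_cols_mult_vec:
  assumes "\<And>j. j \<in> set js \<Longrightarrow> G j \<in> carrier_mat r (d j)"
    and "\<And>j. j \<in> set js \<Longrightarrow> U j \<in> carrier_vec (d j)"
    and "p < r"
  shows "(stack_cols r (map G js) *\<^sub>v stack_vecs (map U js)) $ p = (\<Sum>j\<leftarrow>js. (G j *\<^sub>v U j) $ p)"
  using assms
proof (induction js)
  case Nil
  then show ?case by (simp add: scalar_prod_def)
next
  case (Cons j js)
  have "stack_cols r (map G (j # js)) *\<^sub>v stack_vecs (map U (j # js))
      = G j *\<^sub>v U j + stack_cols r (map G js) *\<^sub>v stack_vecs (map U js)"
    using append_cols_mult_vec[of "G j" r "d j" "stack_cols r (map G js)" "\<Sum>j\<leftarrow>js. d j"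
        "U j" "stack_vecs (map U js)"]
      Cons.prems stack_cols_carrier[of js G r d] stack_vecs_carrier[of js U d]
    by simp
  moreover have "dim_row (stack_cols r (map G js)) = r"
    using Cons.prems stack_cols_carrier[of js G r d] by auto
  ultimately show ?case
    using Cons by simp
qed

lemma stack_rows_mult_vec:
  assumes "\<And>j. j \<in> set js \<Longrightarrow> R j \<in> carrier_mat r c" and "x \<in> carrier_vec c"
  shows "stack_rows c (map R js) *\<^sub>v x = stack_vecs (map (\<lambda>j. R j *\<^sub>v x) js)"
  using assms
proof (induction js)
  case Nil
  then show ?case by (intro eq_vecI) auto
next
  case (Cons j js)
  then show ?case
    using mat_mult_append[of "R j" r c "stack_rows c (map R js)" "length js * r" x]
      stack_rows_carrier[of js R r c]
    by simp
qed

lemma toeplitz_row_carrier: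
  assumes "\<And>k. g k \<in> carrier_mat r c"
  shows "stack_cols r (map (\<lambda>l. if l \<le> j then g (j - l) else 0\<^sub>m r c) [1..<T+1])
    \<in> carrier_mat r (T * c)"
  using stack_cols_carrier[of "[1..<T+1]" "\<lambda>l. if l \<le> j then g (j - l) else 0\<^sub>m r c" r "\<lambda>_. c"] assms
  by (simp add: sum_list_triv)

lemma lower_block_toeplitz_carrier:
  assumes "\<And>k. g k \<in> carrier_mat r c"
  shows "lower_block_toeplitz r c T g \<in> carrier_mat (T * r) (T * c)"
  using stack_rows_carrier[of "[1..<T+1]"
      "\<lambda>j. stack_cols r (map (\<lambda>l. if l \<le> j then g (j - l) else 0\<^sub>m r c) [1..<T+1])" r "T * c"]
    toeplitz_row_carrier[of g r c] assms
  by (simp add: lower_block_toeplitz_def)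

text \<open>The blocks above the diagonal vanish, so block row \<open>j\<close> only sees the inputs up to time \<open>j\<close>:
  multiplication by a lower block Toeplitz matrix is causal convolution with its first
  block column.\<close>

lemma lower_block_toeplitz_mult_vec:
  assumes g: "\<And>k. g k \<in> carrier_mat r c" and U: "\<And>l. U l \<in> carrier_vec c"
  shows "lower_block_toeplitz r c T g *\<^sub>v stack_vecs (map U [1..<T+1])
    = stack_vecs (map (\<lambda>j. vec r (\<lambda>p. \<Sum>l=1..j. (g (j - l) *\<^sub>v U l) $ p)) [1..<T+1])"
proof -
  let ?G = "\<lambda>j l. if l \<le> j then g (j - l) else 0\<^sub>m r c"
  let ?R = "\<lambda>j. stack_cols r (map (?G j) [1..<T+1])"
  let ?U = "stack_vecs (map U [1..<T+1])"
  have R: "?R j \<in> carrier_mat r (T * c)" for j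
    by (rule toeplitz_row_carrier[OF g])
  have Uc: "?U \<in> carrier_vec (T * c)"
    using stack_vecs_carrier_const[of "[1..<T+1]" U c] U by simp
  have row: "?R j *\<^sub>v ?U = vec r (\<lambda>p. \<Sum>l=1..j. (g (j - l) *\<^sub>v U l) $ p)" if "j \<in> set [1..<T+1]" for j
  proof (rule eq_vecI)
    fix p assume "p < dim_vec (vec r (\<lambda>p. \<Sum>l=1..j. (g (j - l) *\<^sub>v U l) $ p))"
    then have p: "p < r" by simp
    have "(?R j *\<^sub>v ?U) $ p = (\<Sum>l\<leftarrow>[1..<T+1]. (?G j l *\<^sub>v U l) $ p)"
      by (rule stack_cols_mult_vec[where d = "\<lambda>_. c"]) (use g U p in auto)
    also have "\<dots> = (\<Sum>l\<in>{1..<T+1}. (?G j l *\<^sub>v U l) $ p)"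
      by (simp only: interv_sum_list_conv_sum_set_nat set_upt)
    also have "\<dots> = (\<Sum>l=1..j. (g (j - l) *\<^sub>v U l) $ p)"
      using that p carrier_vecD[OF U]
      by (intro sum.mono_neutral_cong_right) (auto simp: scalar_prod_def)
    finally show "(?R j *\<^sub>v ?U) $ p = vec r (\<lambda>p. \<Sum>l=1..j. (g (j - l) *\<^sub>v U l) $ p) $ p"
      using p by simp
  qed (use R in auto)
  have "lower_block_toeplitz r c T g *\<^sub>v ?U = stack_vecs (map (\<lambda>j. ?R j *\<^sub>v ?U) [1..<T+1])"
    unfolding lower_block_toeplitz_def by (rule stack_rows_mult_vec[OF R Uc])
  also have "\<dots> = stack_vecs (map (\<lambda>j. vec r (\<lambda>p. \<Sum>l=1..j. (g (j - l) *\<^sub>v U l) $ p)) [1..<T+1])"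
    by (rule arg_cong[where f = stack_vecs], rule map_cong[OF refl row])
  finally show ?thesis .
qed

section \<open>Cancellation of the interconnection\<close>

text \<open>The state of the linear system \<open>(A, B)\<close> under the input \<open>u\<close>, started at the origin.\<close>

primrec forced_response :: "real mat \<Rightarrow> real mat \<Rightarrow> (nat \<Rightarrow> real vec) \<Rightarrow> nat \<Rightarrow> real vec" where
  "forced_response A B u 0 = 0\<^sub>v (dim_row A)"
| "forced_response A B u (Suc k) = A *\<^sub>v forced_response A B u k + B *\<^sub>v u k"

lemma forced_response_carrier:
  assumes "A \<in> carrier_mat n n" "B \<in> carrier_mat n m"
  shows "forced_response A B u k \<in> carrier_vec n"
  using assms by (cases k) (auto intro!: carrier_vecI)

text \<open>The induction runs over all output matrices \<open>C\<close> at once: one step of the recursion replaces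
  \<open>C\<close> by \<open>C * A\<close>.\<close>

lemma forced_response_convolution:
  assumes A: "A \<in> carrier_mat n n" and B: "B \<in> carrier_mat n m" and C: "C \<in> carrier_mat r n"
    and u: "\<And>k. u k \<in> carrier_vec m" and p: "p < r"
  shows "(C *\<^sub>v forced_response A B u j) $ p = (\<Sum>l=1..j. ((C * A ^\<^sub>m (j - l) * B) *\<^sub>v u (l - 1)) $ p)"
  using C
proof (induction j arbitrary: C)
  case 0
  then show ?case using A p by (simp add: scalar_prod_def)
next
  case (Suc j)
  let ?d = "forced_response A B u"
  have pow: "A ^\<^sub>m k \<in> carrier_mat n n" for k
    using A by simp
  have step: "C * A * A ^\<^sub>m (j - l) * B = C * A ^\<^sub>m (Suc j - l) * B" if "l \<in> {1..j}" for l
  proof -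
    have "C * A * A ^\<^sub>m (j - l) = C * (A * A ^\<^sub>m (j - l))"
      using Suc.prems A pow by (intro assoc_mult_mat) auto
    also have "A * A ^\<^sub>m (j - l) = A ^\<^sub>m (Suc j - l)"
      using that pow_mat_Suc_left[OF A, of "j - l"] by (simp add: Suc_diff_le)
    finally show ?thesis by simp
  qed
  have "C *\<^sub>v ?d (Suc j) = (C * A) *\<^sub>v ?d j + (C * B) *\<^sub>v u j"
    using forced_response_carrier[OF A B, of u j] Suc.prems A B u
    by (simp add: mult_add_distrib_mat_vec[of C r n] assoc_mult_mat_vec[of C r n])
  then have "(C *\<^sub>v ?d (Suc j)) $ p = ((C * A) *\<^sub>v ?d j) $ p + ((C * B) *\<^sub>v u j) $ p"
    using Suc.prems p by simp
  also have "((C * A) *\<^sub>v ?d j) $ p = (\<Sum>l=1..j. ((C * A * A ^\<^sub>m (j - l) * B) *\<^sub>v u (l - 1)) $ p)"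
    using Suc.prems A by (intro Suc.IH) auto
  also have "\<dots> = (\<Sum>l=1..j. ((C * A ^\<^sub>m (Suc j - l) * B) *\<^sub>v u (l - 1)) $ p)"
    by (intro sum.cong refl) (simp add: step)
  finally show ?case
    using Suc.prems A by simp
qed

lemma others_subset: "set (others S i) \<subseteq> subsystems S"
  by (auto simp: others_def)

lemma B_mat_carrier:
  assumes "well_dimensioned S" "i \<in> subsystems S"
  shows "B_mat S i \<in> carrier_mat (dim_x S i) (dim_u S i)"
  unfolding B_mat_def dim_u_def
  using assms others_subset[of S i] by (intro stack_cols_carrier) (auto simp: well_dimensioned_def)

text \<open>Block \<open>l\<close> of the Toeplitz matrix, counted from 1, acts on the input at time \<open>l - 1\<close>, because a
  state depends on the inputs strictly before it.\<close>

lemma F_u_mult_interconnection: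
  assumes wd: "well_dimensioned S" and i: "i \<in> subsystems S"
    and u: "\<And>k. u k \<in> carrier_vec (dim_u S i)"
  shows "F_u S T i *\<^sub>v stack_vecs (map (\<lambda>l. u (l - 1)) [1..<T+1])
    = stack_vecs (map (\<lambda>k. C_mat S i *\<^sub>v forced_response (A_mat S i i) (B_mat S i) u k) [1..<T+1])"
proof -
  have A: "A_mat S i i \<in> carrier_mat (dim_x S i) (dim_x S i)"
    and C: "C_mat S i \<in> carrier_mat (dim_y S i) (dim_x S i)"
    using wd i by (auto simp: well_dimensioned_def)
  note B = B_mat_carrier[OF wd i]
  let ?g = "\<lambda>k. C_mat S i * A_mat S i i ^\<^sub>m k * B_mat S i"
  have g: "?g k \<in> carrier_mat (dim_y S i) (dim_u S i)" for k
    using A B C by (intro mult_carrier_mat) auto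
  show ?thesis
    unfolding F_u_def lower_block_toeplitz_mult_vec[OF g u]
  proof (intro arg_cong[where f = stack_vecs] map_cong refl eq_vecI)
    fix j p
    assume "p < dim_vec (C_mat S i *\<^sub>v forced_response (A_mat S i i) (B_mat S i) u j)"
    then have p: "p < dim_y S i" using C by simp
    show "vec (dim_y S i) (\<lambda>p. \<Sum>l=1..j. (?g (j - l) *\<^sub>v u (l - 1)) $ p) $ p
      = (C_mat S i *\<^sub>v forced_response (A_mat S i i) (B_mat S i) u j) $ p"
      unfolding index_vec[OF p] forced_response_convolution[OF A B C u p] ..
  qed (use C in simp)
qed

lemma obs_mat_carrier:
  assumes "well_dimensioned S" "i \<in> subsystems S"
  shows "obs_mat S T i \<in> carrier_mat (T * dim_y S i) (dim_x S i)"
proof -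
  have "obs_mat S T i \<in> carrier_mat (length [1..<T+1] * dim_y S i) (dim_x S i)"
    unfolding obs_mat_def using assms
    by (intro stack_rows_carrier mult_carrier_mat) (auto simp: well_dimensioned_def)
  then show ?thesis by simp
qed

lemma F_u_carrier:
  assumes wd: "well_dimensioned S" and i: "i \<in> subsystems S"
  shows "F_u S T i \<in> carrier_mat (T * dim_y S i) (T * dim_u S i)"
  unfolding F_u_def using wd i B_mat_carrier[OF wd i]
  by (intro lower_block_toeplitz_carrier mult_carrier_mat) (auto simp: well_dimensioned_def)

lemma left_null_basis_dim_col:
  assumes "well_dimensioned S" "i \<in> subsystems S" "left_null_basis (nuisance_mat S T i) N"
  shows "dim_col N = T * dim_y S i"
  using assms obs_mat_carrier[of S i T]
  by (simp add: left_null_basis_def nuisance_mat_def append_cols_def)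

text \<open>Every row of \<open>N\<close> annihilates \<open>[obs_mat  F_u]\<close>, hence in particular its second block.\<close>

lemma left_null_basis_cancels_F_u:
  assumes wd: "well_dimensioned S" and i: "i \<in> subsystems S"
    and N: "left_null_basis (nuisance_mat S T i) N"
    and U: "U \<in> carrier_vec (T * dim_u S i)"
  shows "N *\<^sub>v (F_u S T i *\<^sub>v U) = 0\<^sub>v (dim_row N)"
proof -
  let ?Q = "nuisance_mat S T i"
  let ?r = "T * dim_y S i"
  note O = obs_mat_carrier[OF wd i, of T] and F = F_u_carrier[OF wd i, of T]
  have Q: "?Q \<in> carrier_mat ?r (dim_x S i + T * dim_u S i)"
    unfolding nuisance_mat_def by (rule append_cols_carrier[OF O F])
  let ?z = "0\<^sub>v (dim_x S i) @\<^sub>v U"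
  have z: "?z \<in> carrier_vec (dim_x S i + T * dim_u S i)"
    using U by simp
  \<comment> \<open>Padding \<open>U\<close> with a zero initial state selects the second block of the nuisance matrix.\<close>
  have Qz: "?Q *\<^sub>v ?z = F_u S T i *\<^sub>v U"
    unfolding nuisance_mat_def append_cols_mult_vec[OF O F zero_carrier_vec U]
    using O F by (intro eq_vecI) auto
  interpret K: kernel "dim_col ?Q" "dim_row ?Q" "?Q\<^sup>T"
    by unfold_locales auto
  have rows: "set (rows N) \<subseteq> mat_kernel ?Q\<^sup>T"
    using N unfolding left_null_basis_def K.Ker.basis_def by simp
  have "row N p \<bullet> (F_u S T i *\<^sub>v U) = 0" if "p < dim_row N" for p
  proof -
    have "row N p \<in> mat_kernel ?Q\<^sup>T"
      using rows that by (auto simp: rows_def)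
    then have x: "row N p \<in> carrier_vec ?r" "?Q\<^sup>T *\<^sub>v row N p = 0\<^sub>v (dim_x S i + T * dim_u S i)"
      using Q by (auto simp: mat_kernel_def)
    have "row N p \<bullet> (?Q *\<^sub>v ?z) = (?Q\<^sup>T *\<^sub>v row N p) \<bullet> ?z"
      using transpose_vec_mult_scalar[OF Q z x(1)] by simp
    also have "\<dots> = 0"
      using z by (simp add: x(2))
    finally show ?thesis by (simp add: Qz)
  qed
  then show ?thesis
    by (intro eq_vecI) auto
qed

text \<open>The state that subsystem \<open>i\<close> would have if the inputs from its neighbours were
  removed. It reads no noise but its own.\<close>

primrec isolated_state :: "net_system \<Rightarrow> signal \<Rightarrow> nat \<Rightarrow> (nat \<Rightarrow> real vec) \<Rightarrow> nat \<Rightarrow> real vec" where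
  "isolated_state S ua i wi 0 = x_init S i"
| "isolated_state S ua i wi (Suc k) =
     A_mat S i i *\<^sub>v isolated_state S ua i wi k + Ba_mat S i *\<^sub>v ua i k + wi k"

definition isolated_stat ::
  "net_system \<Rightarrow> nat \<Rightarrow> (nat \<Rightarrow> real mat) \<Rightarrow> signal \<Rightarrow> nat \<Rightarrow> (nat \<Rightarrow> real vec) \<Rightarrow> (nat \<Rightarrow> real vec) \<Rightarrow> real" where
  "isolated_stat S T Nm ua i wi vi =
     (let y = Nm i *\<^sub>v stack_vecs (map (\<lambda>k. C_mat S i *\<^sub>v isolated_state S ua i wi k + vi k) [1..<T+1])
      in y \<bullet> (the (mat_inverse (Sigma_tilde S T Nm i)) *\<^sub>v y))"

lemma isolated_state_carrier:
  assumes "well_dimensioned S" "i \<in> subsystems S" "\<And>k. wi k \<in> carrier_vec (dim_x S i)"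
  shows "isolated_state S ua i wi k \<in> carrier_vec (dim_x S i)"
  using assms by (cases k) (auto simp: well_dimensioned_def intro!: carrier_vecI)

lemma state_carrier:
  assumes "well_dimensioned S" "i \<in> subsystems S" "\<And>k. w i k \<in> carrier_vec (dim_x S i)"
  shows "state S ua w k i \<in> carrier_vec (dim_x S i)"
  using assms by (cases k) (auto simp: well_dimensioned_def intro!: carrier_vecI)

text \<open>By superposition the full state exceeds the isolated state by the forced response to the
  neighbours' states. These contain the noises of all subsystems, but they enter only through
  \<open>B_mat S i\<close>.\<close>

lemma state_decomposition:
  assumes wd: "well_dimensioned S" and i: "i \<in> subsystems S"
    and w: "\<And>j k. j \<in> subsystems S \<Longrightarrow> w j k \<in> carrier_vec (dim_x S j)"
  shows "state S ua w k i = isolated_state S ua i (w i) k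
    + forced_response (A_mat S i i) (B_mat S i)
        (\<lambda>k. stack_vecs (map (\<lambda>j. state S ua w k j) (others S i))) k"
    (is "_ = _ + forced_response ?A ?B ?u k")
proof (induction k)
  case 0
  have "A_mat S i i \<in> carrier_mat (dim_x S i) (dim_x S i)" "x_init S i \<in> carrier_vec (dim_x S i)"
    using wd i by (auto simp: well_dimensioned_def)
  then show ?case by simp
next
  case (Suc k)
  have A: "?A \<in> carrier_mat (dim_x S i) (dim_x S i)" and Ba: "Ba_mat S i \<in> carrier_mat (dim_x S i) (dim_a S i)"
    using wd i by (auto simp: well_dimensioned_def)
  note B = B_mat_carrier[OF wd i]
  let ?z = "isolated_state S ua i (w i) k" and ?d = "forced_response ?A ?B ?u k"
  have z: "?z \<in> carrier_vec (dim_x S i)"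
    using wd i w by (intro isolated_state_carrier) auto
  have d: "?d \<in> carrier_vec (dim_x S i)"
    by (rule forced_response_carrier[OF A B])
  have "state S ua w (Suc k) i = ?A *\<^sub>v (?z + ?d) + ?B *\<^sub>v ?u k + Ba_mat S i *\<^sub>v ua i k + w i k"
    by (simp only: state.simps Suc.IH)
  also have "?A *\<^sub>v (?z + ?d) = ?A *\<^sub>v ?z + ?A *\<^sub>v ?d"
    using mult_add_distrib_mat_vec[OF A z d] .
  finally show ?case
    using A B Ba w[OF i, of k] by (intro eq_vecI) auto
qed

text \<open>The projection by \<open>N\<close> removes the forced response, so the local statistic is a function of
  the local noises alone.\<close>

lemma test_stat_eq_isolated_stat:
  assumes wd: "well_dimensioned S" and i: "i \<in> subsystems S"
    and N: "left_null_basis (nuisance_mat S T i) (Nm i)"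
    and w: "\<And>j k. j \<in> subsystems S \<Longrightarrow> w j k \<in> carrier_vec (dim_x S j)"
    and v: "\<And>k. v i k \<in> carrier_vec (dim_y S i)"
  shows "test_stat S T Nm ua w v i = isolated_stat S T Nm ua i (w i) (v i)"
proof -
  let ?u = "\<lambda>k. stack_vecs (map (\<lambda>j. state S ua w k j) (others S i))"
  let ?z = "isolated_state S ua i (w i)"
  let ?d = "forced_response (A_mat S i i) (B_mat S i) ?u"
  let ?U = "stack_vecs (map (\<lambda>l. ?u (l - 1)) [1..<T+1])"
  let ?Y = "stack_vecs (map (\<lambda>k. C_mat S i *\<^sub>v ?z k + v i k) [1..<T+1])"
  have A: "A_mat S i i \<in> carrier_mat (dim_x S i) (dim_x S i)"
    and C: "C_mat S i \<in> carrier_mat (dim_y S i) (dim_x S i)"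
    using wd i by (auto simp: well_dimensioned_def)
  note B = B_mat_carrier[OF wd i]
  have u: "?u k \<in> carrier_vec (dim_u S i)" for k
    unfolding dim_u_def using wd w others_subset[of S i]
    by (intro stack_vecs_carrier state_carrier) auto
  have z: "?z k \<in> carrier_vec (dim_x S i)" for k
    using wd i w by (intro isolated_state_carrier) auto
  have d: "?d k \<in> carrier_vec (dim_x S i)" for k
    by (rule forced_response_carrier[OF A B])
  have Cd: "C_mat S i *\<^sub>v ?d k \<in> carrier_vec (dim_y S i)" for k
    by (rule mult_mat_vec_closed[OF C])
  have Cz: "C_mat S i *\<^sub>v ?z k + v i k \<in> carrier_vec (dim_y S i)" for k
    by (rule add_carrier_vec[OF mult_mat_vec_closed[OF C] v])
  have U: "?U \<in> carrier_vec (T * dim_u S i)"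
    using stack_vecs_carrier_const[of "[1..<T+1]" "\<lambda>l. ?u (l - 1)"] u by simp
  have meas: "measurement S ua w v i k = C_mat S i *\<^sub>v ?d k + (C_mat S i *\<^sub>v ?z k + v i k)" for k
  proof -
    have "measurement S ua w v i k = C_mat S i *\<^sub>v (?z k + ?d k) + v i k"
      unfolding measurement_def using state_decomposition[OF wd i w] by simp
    also have "C_mat S i *\<^sub>v (?z k + ?d k) = C_mat S i *\<^sub>v ?z k + C_mat S i *\<^sub>v ?d k"
      using mult_add_distrib_mat_vec[OF C z d] .
    finally show ?thesis
      using C by (intro eq_vecI) (auto simp: carrier_vecD[OF v])
  qed
  have FU_eq: "F_u S T i *\<^sub>v ?U = stack_vecs (map (\<lambda>k. C_mat S i *\<^sub>v ?d k) [1..<T+1])"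
    by (rule F_u_mult_interconnection[where u = ?u, OF wd i u])
  have Y: "Y_agg S T ua w v i = F_u S T i *\<^sub>v ?U + ?Y"
    unfolding Y_agg_def meas FU_eq
    by (rule stack_vecs_add[OF Cd Cz])
  have FU: "F_u S T i *\<^sub>v ?U \<in> carrier_vec (T * dim_y S i)"
    by (rule mult_mat_vec_closed[OF F_u_carrier[OF wd i]])
  have Yc: "?Y \<in> carrier_vec (T * dim_y S i)"
    using stack_vecs_carrier_const[of "[1..<T+1]" "\<lambda>k. C_mat S i *\<^sub>v ?z k + v i k"] Cz by simp
  have Nc: "Nm i \<in> carrier_mat (dim_row (Nm i)) (T * dim_y S i)"
    using left_null_basis_dim_col[OF wd i N] by auto
  have "Y_tilde S T Nm ua w v i = Nm i *\<^sub>v (F_u S T i *\<^sub>v ?U) + Nm i *\<^sub>v ?Y"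
    unfolding Y_tilde_def Y using mult_add_distrib_mat_vec[OF Nc FU Yc] .
  also have "\<dots> = Nm i *\<^sub>v ?Y"
    unfolding left_null_basis_cancels_F_u[OF wd i N U] by (intro eq_vecI) auto
  finally show ?thesis
    by (simp add: test_stat_def isolated_stat_def Let_def)
qed

section \<open>Measurability of the local statistics\<close>

lemma space_vec_borel [simp]: "space (vec_borel d) = carrier_vec d"
  by (simp add: vec_borel_def)

lemma measurable_vec_borelI:
  assumes "\<And>x. x \<in> space N \<Longrightarrow> f x \<in> carrier_vec d"
    and "\<And>j. j < d \<Longrightarrow> (\<lambda>x. f x $ j) \<in> borel_measurable N"
  shows "f \<in> measurable N (vec_borel d)"
  unfolding vec_borel_def
proof (rule measurable_vimage_algebra2)
  show "(\<lambda>x. \<lambda>j\<in>{..<d}. f x $ j) \<in> measurable N (\<Pi>\<^sub>M j\<in>{..<d}. borel)"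
    using assms(2) by (intro measurable_restrict) auto
qed (use assms(1) in auto)

lemma measurable_vec_index:
  assumes f: "f \<in> measurable N (vec_borel d)" and j: "j < d"
  shows "(\<lambda>x. f x $ j) \<in> borel_measurable N"
proof -
  have coord: "(\<lambda>x. \<lambda>j\<in>{..<d}. x $ j :: real) \<in> measurable (vec_borel d) (\<Pi>\<^sub>M j\<in>{..<d}. borel)"
    unfolding vec_borel_def by (rule measurable_vimage_algebra1) (auto simp: space_PiM)
  have "(\<lambda>x. (\<lambda>j\<in>{..<d}. f x $ j) j) \<in> borel_measurable N"
    using measurable_compose[OF measurable_compose[OF f coord] measurable_component_singleton[of j]] j
    by simp
  then show ?thesis using j by simp
qed

lemma measurable_vec_carrier:
  "f \<in> measurable N (vec_borel d) \<Longrightarrow> x \<in> space N \<Longrightarrow> f x \<in> carrier_vec d"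
  using measurable_space[of f N "vec_borel d" x] by simp

lemma measurable_vec_add:
  assumes f: "f \<in> measurable N (vec_borel d)" and g: "g \<in> measurable N (vec_borel d)"
  shows "(\<lambda>x. f x + g x) \<in> measurable N (vec_borel d)"
proof (rule measurable_vec_borelI)
  fix j assume j: "j < d"
  have "(\<lambda>x. f x $ j + g x $ j) \<in> borel_measurable N"
    using measurable_vec_index[OF f j] measurable_vec_index[OF g j] by simp
  then show "(\<lambda>x. (f x + g x) $ j) \<in> borel_measurable N"
    by (rule subst[OF measurable_cong, rotated])
      (use j measurable_vec_carrier[OF g] in fastforce)
qed (use measurable_vec_carrier[OF f] measurable_vec_carrier[OF g] in auto)

lemma measurable_vec_scalar_prod:
  assumes f: "f \<in> measurable N (vec_borel d)" and g: "g \<in> measurable N (vec_borel d)"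
  shows "(\<lambda>x. f x \<bullet> g x) \<in> borel_measurable N"
proof -
  have "(\<lambda>x. \<Sum>j\<in>{0..<d}. f x $ j * g x $ j) \<in> borel_measurable N"
    using measurable_vec_index[OF f] measurable_vec_index[OF g]
    by (intro borel_measurable_sum borel_measurable_times) auto
  then show ?thesis
    by (rule subst[OF measurable_cong, rotated])
      (use measurable_vec_carrier[OF g] in \<open>force simp: scalar_prod_def\<close>)
qed

lemma measurable_vec_const:
  "c \<in> carrier_vec d \<Longrightarrow> (\<lambda>_. c) \<in> measurable N (vec_borel d)"
  by (intro measurable_const) simp

lemma measurable_mult_mat_vec:
  assumes A: "A \<in> carrier_mat r c" and f: "f \<in> measurable N (vec_borel c)"
  shows "(\<lambda>x. A *\<^sub>v f x) \<in> measurable N (vec_borel r)"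
proof (rule measurable_vec_borelI)
  fix j assume "j < r"
  moreover have "(\<lambda>x. row A j \<bullet> f x) \<in> borel_measurable N"
    using A f by (intro measurable_vec_scalar_prod[where d = c] measurable_vec_const) auto
  ultimately show "(\<lambda>x. (A *\<^sub>v f x) $ j) \<in> borel_measurable N"
    using A by simp
qed (rule mult_mat_vec_closed[OF A])

lemma measurable_append_vec:
  assumes f: "f \<in> measurable N (vec_borel d)" and g: "g \<in> measurable N (vec_borel e)"
  shows "(\<lambda>x. f x @\<^sub>v g x) \<in> measurable N (vec_borel (d + e))"
proof (rule measurable_vec_borelI)
  fix j assume j: "j < d + e"
  have "(\<lambda>x. if j < d then f x $ j else g x $ (j - d)) \<in> borel_measurable N"
    using measurable_vec_index[OF f, of j] measurable_vec_index[OF g, of "j - d"] j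
    by (cases "j < d") auto
  then show "(\<lambda>x. (f x @\<^sub>v g x) $ j) \<in> borel_measurable N"
    by (rule subst[OF measurable_cong, rotated])
      (use j measurable_vec_carrier[OF f] measurable_vec_carrier[OF g] in fastforce)
qed (use measurable_vec_carrier[OF f] measurable_vec_carrier[OF g] in auto)

lemma measurable_stack_vecs:
  assumes "\<And>j. j \<in> set js \<Longrightarrow> f j \<in> measurable N (vec_borel d)"
  shows "(\<lambda>x. stack_vecs (map (\<lambda>j. f j x) js)) \<in> measurable N (vec_borel (length js * d))"
  using assms by (induction js) (auto intro: measurable_vec_const measurable_append_vec)

text \<open>Invertibility excludes the value \<open>None\<close> of \<open>mat_inverse\<close>, for which \<open>the\<close> would return a matrix
  of unknown dimensions and the quadratic form would read undefined entries.\<close>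

lemma mat_inverse_carrier:
  assumes A: "(A :: 'a :: field mat) \<in> carrier_mat n n" and inv: "invertible_mat A"
  shows "the (mat_inverse A) \<in> carrier_mat n n"
proof -
  obtain B where B: "A * B = 1\<^sub>m (dim_row A)" "B * A = 1\<^sub>m (dim_row B)"
    using inv by (auto simp: invertible_mat_def inverts_mat_def)
  have "dim_col (A * B) = dim_col (1\<^sub>m (dim_row A) :: 'a mat)" "dim_col (B * A) = dim_col (1\<^sub>m (dim_row B) :: 'a mat)"
    using B by simp_all
  then have "B \<in> carrier_mat n n"
    using A by auto
  then have "A \<in> Units (ring_mat TYPE('a) n undefined)"
    using A B by (auto simp: Units_def ring_mat_def)
  then obtain C where C: "mat_inverse A = Some C"
    using mat_inverse(1)[OF A, of undefined] by auto
  then show ?thesis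
    using mat_inverse(2)[OF A C] by simp
qed

lemma isolated_stat_measurable:
  assumes wd: "well_dimensioned S" and i: "i \<in> subsystems S"
    and N: "dim_col (Nm i) = T * dim_y S i"
    and inv: "invertible_mat (Sigma_tilde S T Nm i)"
    and w: "\<And>k. (\<lambda>x. wi x k) \<in> measurable P (vec_borel (dim_x S i))"
    and v: "\<And>k. (\<lambda>x. vi x k) \<in> measurable P (vec_borel (dim_y S i))"
  shows "(\<lambda>x. isolated_stat S T Nm ua i (wi x) (vi x)) \<in> borel_measurable P"
proof -
  have A: "A_mat S i i \<in> carrier_mat (dim_x S i) (dim_x S i)"
    and C: "C_mat S i \<in> carrier_mat (dim_y S i) (dim_x S i)"
    and Ba: "Ba_mat S i \<in> carrier_mat (dim_x S i) (dim_a S i)"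
    and x0: "x_init S i \<in> carrier_vec (dim_x S i)"
    using wd i by (auto simp: well_dimensioned_def)
  have z: "(\<lambda>x. isolated_state S ua i (wi x) k) \<in> measurable P (vec_borel (dim_x S i))" for k
  proof (induction k)
    case 0
    then show ?case using x0 by (simp add: measurable_vec_const)
  next
    case (Suc k)
    then show ?case
      using A Ba w by (auto intro!: measurable_vec_add measurable_mult_mat_vec measurable_vec_const
          mult_mat_vec_closed)
  qed
  have Nc: "Nm i \<in> carrier_mat (dim_row (Nm i)) (length [1..<T+1] * dim_y S i)"
    using N by auto
  have y: "(\<lambda>x. Nm i *\<^sub>v stack_vecs (map (\<lambda>k. C_mat S i *\<^sub>v isolated_state S ua i (wi x) k + vi x k) [1..<T+1]))
      \<in> measurable P (vec_borel (dim_row (Nm i)))"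
    by (intro measurable_mult_mat_vec[OF Nc] measurable_stack_vecs measurable_vec_add
        measurable_mult_mat_vec[OF C] z v)
  have "Sigma_tilde S T Nm i \<in> carrier_mat (dim_row (Nm i)) (dim_row (Nm i))"
    unfolding Sigma_tilde_def by auto
  then have Q: "the (mat_inverse (Sigma_tilde S T Nm i)) \<in> carrier_mat (dim_row (Nm i)) (dim_row (Nm i))"
    using inv by (rule mat_inverse_carrier)
  show ?thesis
    unfolding isolated_stat_def Let_def
    by (rule measurable_vec_scalar_prod[OF y measurable_mult_mat_vec[OF Q y]])
qed

section \<open>Independence of the local detectors\<close>

lemma (in prob_space) prob_some_exceeds_indep:
  fixes X :: "'i \<Rightarrow> 'a \<Rightarrow> real"
  assumes X: "indep_vars (\<lambda>_. borel) X I" and I: "finite I" "I \<noteq> {}"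
  shows "prob {\<omega> \<in> space M. \<exists>i\<in>I. X i \<omega> \<ge> t i} = 1 - (\<Prod>i\<in>I. 1 - prob {\<omega> \<in> space M. X i \<omega> \<ge> t i})"
proof -
  have rv [measurable]: "X i \<in> borel_measurable M" if "i \<in> I" for i
    using X that by (auto simp: indep_vars_def)
  have compl: "prob (X i -` {..<t i} \<inter> space M) = 1 - prob {\<omega> \<in> space M. X i \<omega> \<ge> t i}" if "i \<in> I" for i
  proof -
    have ev: "{\<omega> \<in> space M. X i \<omega> \<ge> t i} \<in> events"
      using rv[OF that] by measurable
    have "X i -` {..<t i} \<inter> space M = space M - {\<omega> \<in> space M. X i \<omega> \<ge> t i}"
      by auto
    then show ?thesis using prob_compl[OF ev] by simp
  qed
  have "{\<omega> \<in> space M. \<exists>i\<in>I. X i \<omega> \<ge> t i} = space M - (\<Inter>i\<in>I. X i -` {..<t i} \<inter> space M)"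
    using I by (auto simp: not_less)
  moreover have "(\<Inter>i\<in>I. X i -` {..<t i} \<inter> space M) \<in> events"
    using I rv by (intro sets.finite_INT) (auto intro: measurable_sets)
  ultimately have "prob {\<omega> \<in> space M. \<exists>i\<in>I. X i \<omega> \<ge> t i} = 1 - prob (\<Inter>i\<in>I. X i -` {..<t i} \<inter> space M)"
    using prob_compl by simp
  also have "prob (\<Inter>i\<in>I. X i -` {..<t i} \<inter> space M) = (\<Prod>i\<in>I. prob (X i -` {..<t i} \<inter> space M))"
    using indep_varsD_finite[OF X I(2,1), of "\<lambda>i. {..<t i}"] by simp
  finally show ?thesis
    using compl by simp
qed

text \<open>The family of all noises is partitioned by subsystem; functions of disjoint groups of an
  independent family are independent.\<close>

lemma (in prob_space) indep_vars_isolated_stat: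
  assumes wd: "well_dimensioned S" and noise: "gaussian_noises M S w v"
    and N: "\<And>i. i \<in> subsystems S \<Longrightarrow> dim_col (Nm i) = T * dim_y S i"
    and inv: "\<And>i. i \<in> subsystems S \<Longrightarrow> invertible_mat (Sigma_tilde S T Nm i)"
  shows "indep_vars (\<lambda>_. borel)
    (\<lambda>i \<omega>. isolated_stat S T Nm ua i (\<lambda>k. w i k \<omega>) (\<lambda>k. v i k \<omega>)) (subsystems S)"
proof -
  let ?M = "case_sum (\<lambda>(i, k). vec_borel (dim_x S i)) (\<lambda>(i, k). vec_borel (dim_y S i))
    :: nat \<times> nat + nat \<times> nat \<Rightarrow> real vec measure"
  let ?X = "case_sum (\<lambda>(i, k). w i k) (\<lambda>(i, k). v i k)"
  let ?K = "\<lambda>i. ({i} \<times> UNIV) <+> ({i} \<times> UNIV) :: (nat \<times> nat + nat \<times> nat) set"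
  let ?f = "\<lambda>i p. isolated_stat S T Nm ua i (\<lambda>k. p (Inl (i, k))) (\<lambda>k. p (Inr (i, k)))"
  have "indep_vars ?M ?X ((subsystems S \<times> UNIV) <+> (subsystems S \<times> UNIV))"
    using noise by (simp add: gaussian_noises_def)
  then have "indep_vars (\<lambda>i. PiM (?K i) ?M) (\<lambda>i \<omega>. restrict (\<lambda>n. ?X n \<omega>) (?K i)) (subsystems S)"
    by (rule indep_vars_restrict) (auto simp: disjoint_family_on_def)
  then have "indep_vars (\<lambda>_. borel) (\<lambda>i \<omega>. ?f i (restrict (\<lambda>n. ?X n \<omega>) (?K i))) (subsystems S)"
  proof (rule indep_vars_compose2)
    fix i assume i: "i \<in> subsystems S"
    have "(\<lambda>p. p (Inl (i, k))) \<in> measurable (PiM (?K i) ?M) (vec_borel (dim_x S i))" for k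
      using measurable_component_singleton[of "Inl (i, k)" "?K i" ?M] by (simp add: InlI)
    moreover have "(\<lambda>p. p (Inr (i, k))) \<in> measurable (PiM (?K i) ?M) (vec_borel (dim_y S i))" for k
      using measurable_component_singleton[of "Inr (i, k)" "?K i" ?M] by (simp add: InrI)
    ultimately show "?f i \<in> measurable (PiM (?K i) ?M) borel"
      using i by (intro isolated_stat_measurable wd N inv) auto
  qed
  then show ?thesis
    by (simp add: InlI InrI)
qed

lemma (in prob_space) decentralized_alarm_prob_eq:
  assumes sub: "num_sub S \<ge> 1" and wd: "well_dimensioned S" and noise: "gaussian_noises M S w v"
   
    and N: "\<And>i. i \<in> subsystems S \<Longrightarrow> left_null_basis (nuisance_mat S T i) (Nm i)"
    and inv: "\<And>i. i \<in> subsystems S \<Longrightarrow> invertible_mat (Sigma_tilde S T Nm i)"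
  shows "decentralized_alarm_prob M S T Nm w v \<tau> ua
    = 1 - (\<Prod>i = 1..num_sub S. 1 - local_alarm_prob M S T Nm w v \<tau> ua i)"
proof -
  let ?\<Lambda> = "\<lambda>i \<omega>. isolated_stat S T Nm ua i (\<lambda>k. w i k \<omega>) (\<lambda>k. v i k \<omega>)"
  have "w i k \<in> measurable M (vec_borel (dim_x S i))" "v i k \<in> measurable M (vec_borel (dim_y S i))"
    if "i \<in> subsystems S" for i k
    using noise that by (auto simp: gaussian_noises_def normal_vec_def)
  then have stat: "test_stat S T Nm ua (\<lambda>i k. w i k \<omega>) (\<lambda>i k. v i k \<omega>) i = ?\<Lambda> i \<omega>"
    if "i \<in> subsystems S" "\<omega> \<in> space M" for i \<omega>
    using that by (intro test_stat_eq_isolated_stat wd N) (auto intro: measurable_vec_carrier)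
  have dimN: "dim_col (Nm i) = T * dim_y S i" if "i \<in> subsystems S" for i
    using left_null_basis_dim_col wd that N[OF that] .
  have "decentralized_alarm_prob M S T Nm w v \<tau> ua = prob {\<omega> \<in> space M. \<exists>i\<in>subsystems S. ?\<Lambda> i \<omega> \<ge> \<tau> i}"
    unfolding decentralized_alarm_prob_def by (intro arg_cong[where f = prob] Collect_cong conj_cong bex_cong refl) (simp only: stat)
  also have "\<dots> = 1 - (\<Prod>i\<in>subsystems S. 1 - prob {\<omega> \<in> space M. ?\<Lambda> i \<omega> \<ge> \<tau> i})"
    using sub by (intro prob_some_exceeds_indep indep_vars_isolated_stat[OF wd noise dimN inv]) auto
  also have "(\<Prod>i\<in>subsystems S. 1 - prob {\<omega> \<in> space M. ?\<Lambda> i \<omega> \<ge> \<tau> i})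
      = (\<Prod>i\<in>subsystems S. 1 - local_alarm_prob M S T Nm w v \<tau> ua i)"
    unfolding local_alarm_prob_def
    by (intro prod.cong refl arg_cong[where f = "\<lambda>A. 1 - prob A"]) (auto simp: stat)
  finally show ?thesis .
qed

theorem mainTheorem7:
  fixes M :: "'w measure" and S :: net_system and T :: nat
    and w v :: "nat \<Rightarrow> nat \<Rightarrow> 'w \<Rightarrow> real vec"
    and Nm :: "nat \<Rightarrow> real mat" and \<tau> :: "nat \<Rightarrow> real" and ua :: signal
  assumes "prob_space M"
    and "num_sub S \<ge> 1"
    and "well_dimensioned S"
    and "gaussian_noises M S w v"
    and "T > 0"
    and "attack_signal S ua"
    and "\<And>i. i \<in> subsystems S \<Longrightarrow> mat_kernel (nuisance_mat S T i)\<^sup>T \<noteq> {0\<^sub>v (dim_row (nuisance_mat S T i))}"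
    and "\<And>i. i \<in> subsystems S \<Longrightarrow> left_null_basis (nuisance_mat S T i) (Nm i)"
    and "\<And>i. i \<in> subsystems S \<Longrightarrow> invertible_mat (Sigma_tilde S T Nm i)"
    and "\<And>i. i \<in> subsystems S \<Longrightarrow> \<tau> i \<ge> 0"
  shows "decentralized_alarm_prob M S T Nm w v \<tau> (no_attack S)
           = 1 - (\<Prod>i = 1..num_sub S. 1 - local_alarm_prob M S T Nm w v \<tau> (no_attack S) i)
       \<and> decentralized_alarm_prob M S T Nm w v \<tau> ua
           = 1 - (\<Prod>i = 1..num_sub S. 1 - local_alarm_prob M S T Nm w v \<tau> ua i)"
proof -
  interpret prob_space M by fact
  show ?thesis
    using decentralized_alarm_prob_eq[OF assms(2-4,8,9)] by blast
qed

end
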